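(* Let $\alpha_1, A_1, \alpha_2, \gamma_2 > 0$ and consider the system of difference equations $$x_{n+1}=\frac{\alpha_{1}}{A_{1}+y_{n}},\qquad y_{n+1}=\frac{\alpha_{2}+\gamma_{2}y_{n}}{y_{n}},\qquad n=0,1,2,\dots,$$ with arbitrary nonnegative initial conditions $x_0,y_0$ such that the denominators are never zero. There is a unique equilibrium, namely $$\left(\frac{2\alpha_{1}}{2A_{1}+\gamma_{2}+\sqrt{\gamma_{2}^{2}+4\alpha_{2}}},\frac{\gamma_{2}+\sqrt{\gamma_{2}^{2}+4\alpha_{2}}}{2}\right),$$ and it is globally asymptotically stable.
   Context: The state space consists of nonnegative points. An initial condition $(x_0,y_0)\in[0,\infty)^2$ is admissible if no denominator ever vanishes along its orbit (here this means $x_0\ge 0$, $y_0>0$). An equilibrium is an admissible point $(\bar x,\bar y)\in[0,\infty)^2$ such that the constant sequence $(x_n,y_n)=(\bar x,\bar y)$ solves the system. It is globally asymptotically stable if it is Lyapunov stable (for every $\varepsilon>0$ there is $\delta>0$ such that every admissible initial condition within $\delta$ of $(\bar x,\bar y)$ has its whole orbit within $\varepsilon$ of $(\bar x,\bar y)$) and every solution with admissible initial condition converges to $(\bar x,\bar y)$. *)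

theory Defs
  imports "HOL-Analysis.Analysis"
begin

text \<open>
  A planar system is given by its step map \<open>F\<close> together with the predicate \<open>D\<close> saying that
  no denominator of the step vanishes at a point. Since division is total in HOL, \<open>F\<close> has a
  (meaningless) value also where \<open>D\<close> fails; admissibility excludes all orbits meeting such points.
\<close>

definition admissible :: "(real \<times> real \<Rightarrow> real \<times> real) \<Rightarrow> (real \<times> real \<Rightarrow> bool) \<Rightarrow> real \<times> real \<Rightarrow> bool"
  where "admissible F D z \<longleftrightarrow> fst z \<ge> 0 \<and> snd z \<ge> 0 \<and> (\<forall>n. D ((F ^^ n) z))"

definition is_solution :: "(real \<times> real \<Rightarrow> real \<times> real) \<Rightarrow> (nat \<Rightarrow> real \<times> real) \<Rightarrow> bool"
  where "is_solution F s \<longleftrightarrow> (\<forall>n. s (Suc n) = F (s n))"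

definition equilibrium :: "(real \<times> real \<Rightarrow> real \<times> real) \<Rightarrow> (real \<times> real \<Rightarrow> bool) \<Rightarrow> real \<times> real \<Rightarrow> bool"
  where "equilibrium F D z \<longleftrightarrow> admissible F D z \<and> is_solution F (\<lambda>n. z)"

definition lyapunov_stable :: "(real \<times> real \<Rightarrow> real \<times> real) \<Rightarrow> (real \<times> real \<Rightarrow> bool) \<Rightarrow> real \<times> real \<Rightarrow> bool"
  where "lyapunov_stable F D p \<longleftrightarrow>
    (\<forall>\<epsilon>>0. \<exists>\<delta>>0. \<forall>s. is_solution F s \<and> admissible F D (s 0) \<and> dist (s 0) p < \<delta>
       \<longrightarrow> (\<forall>n. dist (s n) p < \<epsilon>))"

definition globally_attracting :: "(real \<times> real \<Rightarrow> real \<times> real) \<Rightarrow> (real \<times> real \<Rightarrow> bool) \<Rightarrow> real \<times> real \<Rightarrow> bool"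
  where "globally_attracting F D p \<longleftrightarrow>
    (\<forall>s. is_solution F s \<and> admissible F D (s 0) \<longrightarrow> s \<longlonglongrightarrow> p)"

definition globally_asymptotically_stable ::
    "(real \<times> real \<Rightarrow> real \<times> real) \<Rightarrow> (real \<times> real \<Rightarrow> bool) \<Rightarrow> real \<times> real \<Rightarrow> bool"
  where "globally_asymptotically_stable F D p \<longleftrightarrow>
    lyapunov_stable F D p \<and> globally_attracting F D p"

definition rat_step :: "real \<Rightarrow> real \<Rightarrow> real \<Rightarrow> real \<Rightarrow> real \<times> real \<Rightarrow> real \<times> real"
  where "rat_step \<alpha>1 A1 \<alpha>2 \<gamma>2 = (\<lambda>(x, y). (\<alpha>1 / (A1 + y), (\<alpha>2 + \<gamma>2 * y) / y))"

definition rat_dom :: "real \<Rightarrow> real \<times> real \<Rightarrow> bool"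
  where "rat_dom A1 = (\<lambda>(x, y). A1 + y \<noteq> 0 \<and> y \<noteq> 0)"

lemma admissible_rat_iff:
  assumes "\<alpha>1 > 0" "A1 > 0" "\<alpha>2 > 0" "\<gamma>2 > 0"
  shows "admissible (rat_step \<alpha>1 A1 \<alpha>2 \<gamma>2) (rat_dom A1) (x, y) \<longleftrightarrow> x \<ge> 0 \<and> y > 0"
proof
  assume "admissible (rat_step \<alpha>1 A1 \<alpha>2 \<gamma>2) (rat_dom A1) (x, y)"
  then have "x \<ge> 0" "y \<ge> 0" "rat_dom A1 (((rat_step \<alpha>1 A1 \<alpha>2 \<gamma>2) ^^ 0) (x, y))"
    unfolding admissible_def by (simp_all only: fst_conv snd_conv) 
  then show "x \<ge> 0 \<and> y > 0" by (simp add: rat_dom_def)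
next
  assume xy: "x \<ge> 0 \<and> y > 0"
  have "snd (((rat_step \<alpha>1 A1 \<alpha>2 \<gamma>2) ^^ n) (x, y)) > 0" for n
    by (induction n) (use xy assms in \<open>auto simp: rat_step_def split_beta intro!: divide_pos_pos add_pos_pos\<close>)
  then have "rat_dom A1 (((rat_step \<alpha>1 A1 \<alpha>2 \<gamma>2) ^^ n) (x, y))" for n
    using assms(2) by (simp add: rat_dom_def split_beta add_pos_pos less_imp_neq[symmetric])
  then show "admissible (rat_step \<alpha>1 A1 \<alpha>2 \<gamma>2) (rat_dom A1) (x, y)"
    using xy by (simp add: admissible_def)
qed

end

theory Submission
  imports Defs
begin

text \<open>
  The second component evolves on its own by \<open>y \<mapsto> \<gamma> + \<alpha> / y\<close>, whose positive fixed point \<open>Y\<close>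
  satisfies \<open>Y\<^sup>2 = \<alpha> + \<gamma> Y\<close>. One step multiplies \<open>y - Y\<close> by \<open>- \<alpha> / (y Y)\<close>, which is unbounded
  near \<open>y = 0\<close>; but the product of two consecutive values is \<open>\<alpha> + \<gamma> y \<ge> \<alpha>\<close>, so two steps
  contract the distance to \<open>Y\<close> by the factor \<open>\<alpha> / Y\<^sup>2 < 1\<close>, uniformly on \<open>y > 0\<close>. The first component is a
  Lipschitz function of the previous second component, and uniqueness of the equilibrium
  follows from global attraction.
\<close>

text \<open>Even and odd indices decay separately, from \<open>e 0\<close> and \<open>e 1\<close>;
  the sum of the two nonnegative starting values serves both parities at once.\<close>

lemma two_step_contraction_bound:
  fixes e :: "nat \<Rightarrow> real"
  assumes "0 \<le> q" and "\<And>n. 0 \<le> e n" and step: "\<And>n. e (Suc (Suc n)) \<le> q * e n"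
  shows "e n \<le> q ^ (n div 2) * (e 0 + e 1)"
proof (induction n rule: induct_nat_012)
  case (ge2 n)
  have "e (Suc (Suc n)) \<le> q * e n"
    by (rule step)
  also have "\<dots> \<le> q * (q ^ (n div 2) * (e 0 + e 1))"
    using ge2 \<open>0 \<le> q\<close> by (intro mult_left_mono) auto
  finally show ?case
    by (simp add: algebra_simps)
qed (use assms(2)[of 0] assms(2)[of 1] in auto)

lemma two_step_contraction_tendsto_0:
  fixes e :: "nat \<Rightarrow> real"
  assumes "0 \<le> q" "q < 1" and "\<And>n. 0 \<le> e n" and "\<And>n. e (Suc (Suc n)) \<le> q * e n"
  shows "e \<longlonglongrightarrow> 0"
proof -
  have "filterlim (\<lambda>n::nat. n div 2) at_top at_top"
    by (intro filterlim_at_top_div_const_nat) simp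
  then have "(\<lambda>n. q ^ (n div 2)) \<longlonglongrightarrow> 0"
    using LIMSEQ_realpow_zero[OF assms(1,2)] by (rule filterlim_compose[rotated])
  then have "(\<lambda>n. q ^ (n div 2) * (e 0 + e 1)) \<longlonglongrightarrow> 0"
    by (rule tendsto_mult_left_zero)
  moreover have "e n \<le> q ^ (n div 2) * (e 0 + e 1)" for n
    by (rule two_step_contraction_bound) (use assms in auto)
  ultimately show ?thesis
    using assms(3)
    by (intro tendsto_sandwich[of "\<lambda>_. 0" e sequentially "\<lambda>n. q ^ (n div 2) * (e 0 + e 1)"]
        always_eventually allI tendsto_const)
qed

locale rational_system =
  fixes \<alpha>1 A1 \<alpha>2 \<gamma>2 :: real
  assumes pos: "\<alpha>1 > 0" "A1 > 0" "\<alpha>2 > 0" "\<gamma>2 > 0"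
begin

abbreviation "F \<equiv> rat_step \<alpha>1 A1 \<alpha>2 \<gamma>2"
abbreviation "D \<equiv> rat_dom A1"

definition Y :: real where "Y = (\<gamma>2 + sqrt (\<gamma>2\<^sup>2 + 4 * \<alpha>2)) / 2"
definition X :: real where "X = \<alpha>1 / (A1 + Y)"
text \<open>Absolute value of the derivative of \<open>y \<mapsto> \<gamma>2 + \<alpha>2 / y\<close>
  at its fixed point \<open>Y\<close>.\<close>

definition q :: real where "q = \<alpha>2 / Y\<^sup>2"

lemma Y_pos: "Y > 0"
  using pos by (auto simp: Y_def intro!: add_pos_nonneg)

lemma Y_square: "Y\<^sup>2 = \<alpha>2 + \<gamma>2 * Y"
proof -
  have "(sqrt (\<gamma>2\<^sup>2 + 4 * \<alpha>2))\<^sup>2 = \<gamma>2\<^sup>2 + 4 * \<alpha>2"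
    using pos by simp
  then show ?thesis
    by (simp add: Y_def field_simps power2_eq_square)
qed

lemma X_eq: "X = 2 * \<alpha>1 / (2 * A1 + \<gamma>2 + sqrt (\<gamma>2\<^sup>2 + 4 * \<alpha>2))"
proof -
  have "2 * A1 + \<gamma>2 + sqrt (\<gamma>2\<^sup>2 + 4 * \<alpha>2) = 2 * (A1 + Y)"
    by (simp add: Y_def)
  then show ?thesis
    by (simp add: X_def del: distrib_left_numeral)
qed

lemma q_nonneg: "q \<ge> 0"
  using pos by (simp add: q_def)

text \<open>The fixed-point equation makes \<open>Y\<^sup>2\<close> exceed \<open>\<alpha>2\<close>
  by the positive amount \<open>\<gamma>2 * Y\<close>.\<close>

lemma q_less_1: "q < 1"
  using pos Y_pos by (simp add: q_def Y_square divide_less_eq add_pos_pos)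

lemma F_fixed: "F (X, Y) = (X, Y)"
  using Y_pos Y_square by (simp add: rat_step_def X_def field_simps power2_eq_square)

lemma equilibrium_XY: "equilibrium F D (X, Y)"
  using pos Y_pos F_fixed admissible_rat_iff[of \<alpha>1 A1 \<alpha>2 \<gamma>2 X Y]
  by (simp add: equilibrium_def is_solution_def X_def)

text \<open>Subtracting the fixed-point equation \<open>Y = \<alpha>2 / Y + \<gamma>2\<close>
  cancels \<open>\<gamma>2\<close> and leaves a difference of reciprocals.\<close>

lemma step_error:
  assumes "y > 0"
  shows "(\<alpha>2 + \<gamma>2 * y) / y - Y = - \<alpha>2 * (y - Y) / (y * Y)"
proof -
  have "Y = \<alpha>2 / Y + \<gamma>2"
    using Y_pos Y_square by (simp add: field_simps power2_eq_square)
  then have "(\<alpha>2 + \<gamma>2 * y) / y - Y = \<alpha>2 / y - \<alpha>2 / Y"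
    using assms by (simp add: add_divide_distrib)
  also have "\<dots> = - \<alpha>2 * (y - Y) / (y * Y)"
    using assms Y_pos by (simp add: field_simps)
  finally show ?thesis .
qed

lemma two_step_error:
  assumes "y > 0" and "y' = (\<alpha>2 + \<gamma>2 * y) / y" and "y'' = (\<alpha>2 + \<gamma>2 * y') / y'"
  shows "\<bar>y'' - Y\<bar> \<le> q * \<bar>y - Y\<bar>"
proof -
  have y': "y' > 0" and yy': "y' * y = \<alpha>2 + \<gamma>2 * y"
    using assms pos by (auto intro!: divide_pos_pos add_pos_pos)
  have "y'' - Y = - \<alpha>2 * (- \<alpha>2 * (y - Y) / (y * Y)) / (y' * Y)"
    using step_error[OF y'] step_error[OF assms(1)] assms by simp
  \<comment> \<open>Regrouping the two denominators isolates the product \<open>y' * y\<close>,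
    which equals \<open>\<alpha>2 + \<gamma>2 * y\<close> and so stays away from 0 even when
    \<open>y\<close> is small.\<close>
  also have "\<dots> = \<alpha>2 / (y' * y) * (q * (y - Y))"
    using y' Y_pos assms(1) by (simp add: q_def field_simps power2_eq_square)
  finally have "\<bar>y'' - Y\<bar> = \<alpha>2 / (\<alpha>2 + \<gamma>2 * y) * (q * \<bar>y - Y\<bar>)"
    using pos assms(1) q_nonneg by (simp add: yy' abs_mult)
  also have "\<dots> \<le> 1 * (q * \<bar>y - Y\<bar>)"
    using pos assms(1) q_nonneg
    by (intro mult_right_mono) (auto simp: divide_le_eq_1 intro: add_pos_pos)
  finally show ?thesis by simp
qed

lemma first_component_error:
  assumes "y > 0"
  shows "\<bar>\<alpha>1 / (A1 + y) - X\<bar> \<le> \<alpha>1 / A1\<^sup>2 * \<bar>y - Y\<bar>"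
proof -
  have "\<alpha>1 / (A1 + y) - X = \<alpha>1 / ((A1 + y) * (A1 + Y)) * (Y - y)"
    using assms pos Y_pos by (simp add: X_def field_simps add_pos_pos less_imp_neq[symmetric])
  then have "\<bar>\<alpha>1 / (A1 + y) - X\<bar> = \<alpha>1 / ((A1 + y) * (A1 + Y)) * \<bar>y - Y\<bar>"
    using assms pos Y_pos by (simp add: abs_mult abs_minus_commute)
  \<comment> \<open>Both \<open>A1 + y\<close> and \<open>A1 + Y\<close> are at least
    \<open>A1\<close>.\<close>
  also have "\<dots> \<le> \<alpha>1 / A1\<^sup>2 * \<bar>y - Y\<bar>"
    using assms pos Y_pos
    by (intro mult_right_mono divide_left_mono) (auto simp: power2_eq_square intro!: mult_mono)
  finally show ?thesis .
qed

context
  fixes s :: "nat \<Rightarrow> real \<times> real"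
  assumes sol: "is_solution F s" and adm: "admissible F D (s 0)"
begin

lemma fst_Suc: "fst (s (Suc n)) = \<alpha>1 / (A1 + snd (s n))"
  and snd_Suc: "snd (s (Suc n)) = (\<alpha>2 + \<gamma>2 * snd (s n)) / snd (s n)"
  using sol by (simp_all add: is_solution_def rat_step_def split_beta)

lemma snd_pos: "snd (s n) > 0"
proof (induction n)
  case 0
  then show ?case
    using adm admissible_rat_iff[OF pos, of "fst (s 0)" "snd (s 0)"] by simp
next
  case (Suc n)
  then show ?case
    using pos by (auto simp: snd_Suc intro!: divide_pos_pos add_pos_pos)
qed

lemma snd_contraction: "\<bar>snd (s (Suc (Suc n))) - Y\<bar> \<le> q * \<bar>snd (s n) - Y\<bar>"
  by (rule two_step_error[OF snd_pos snd_Suc snd_Suc])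

lemma fst_Suc_error: "\<bar>fst (s (Suc n)) - X\<bar> \<le> \<alpha>1 / A1\<^sup>2 * \<bar>snd (s n) - Y\<bar>"
  unfolding fst_Suc by (rule first_component_error[OF snd_pos])

lemma solution_tendsto: "s \<longlonglongrightarrow> (X, Y)"
proof -
  have err: "(\<lambda>n. \<bar>snd (s n) - Y\<bar>) \<longlonglongrightarrow> 0"
    by (rule two_step_contraction_tendsto_0[OF q_nonneg q_less_1]) (simp_all add: snd_contraction)
  then have "(\<lambda>n. snd (s n)) \<longlonglongrightarrow> Y"
    by (simp add: tendsto_rabs_zero_iff LIM_zero_iff)
  \<comment> \<open>The initial first component is arbitrary, so the Lipschitz bound applies only
    from index 1 on; the limit is then carried back to the unshifted sequence.\<close>
  moreover have "(\<lambda>n. \<bar>fst (s (Suc n)) - X\<bar>) \<longlonglongrightarrow> 0"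
    by (rule tendsto_sandwich[OF _ _ tendsto_const tendsto_mult_right_zero[OF err]])
      (auto intro!: always_eventually fst_Suc_error)
  then have "(\<lambda>n. fst (s n)) \<longlonglongrightarrow> X"
    by (simp add: tendsto_rabs_zero_iff LIM_zero_iff filterlim_sequentially_Suc[of "\<lambda>n. fst (s n)"])
  ultimately have "(\<lambda>n. (fst (s n), snd (s n))) \<longlonglongrightarrow> (X, Y)"
    by (rule tendsto_Pair[rotated])
  then show ?thesis by simp
qed

text \<open>Odd times inherit the error after one step, whose factor
  \<open>\<alpha>2 / (y * Y)\<close> is unbounded as \<open>y\<close> tends to 0. Starting within
  \<open>Y / 2\<close> of the equilibrium forces \<open>y \<ge> Y / 2\<close> and caps this factor
  at 2, so the two starting errors add up to at most 1 + 2 = 3 times the initial distance.\<close>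

lemma snd_error_bound:
  assumes "dist (s 0) (X, Y) \<le> Y / 2"
  shows "\<bar>snd (s n) - Y\<bar> \<le> 3 * dist (s 0) (X, Y)"
proof -
  have d: "\<bar>snd (s 0) - Y\<bar> \<le> dist (s 0) (X, Y)"
    using dist_snd_le[of "s 0" "(X, Y)"] by (simp add: dist_real_def)
  then have "Y / 2 * Y \<le> snd (s 0) * Y"
    using assms Y_pos by (intro mult_right_mono) auto
  moreover have "\<alpha>2 \<le> Y * Y"
    using Y_square pos Y_pos by (simp add: power2_eq_square)
  ultimately have "\<alpha>2 \<le> 2 * (snd (s 0) * Y)"
    by linarith
  then have "\<alpha>2 / (snd (s 0) * Y) \<le> 2"
    using Y_pos snd_pos[of 0] by (simp add: divide_le_eq)
  moreover have "\<bar>snd (s 1) - Y\<bar> = \<alpha>2 / (snd (s 0) * Y) * \<bar>snd (s 0) - Y\<bar>"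
    using step_error[OF snd_pos[of 0]] snd_Suc[of 0] pos Y_pos snd_pos[of 0]
    by (simp add: abs_mult)
  ultimately have "\<bar>snd (s 1) - Y\<bar> \<le> 2 * \<bar>snd (s 0) - Y\<bar>"
    by (metis abs_ge_zero mult_right_mono)
  moreover have "\<bar>snd (s n) - Y\<bar> \<le> q ^ (n div 2) * (\<bar>snd (s 0) - Y\<bar> + \<bar>snd (s 1) - Y\<bar>)"
    by (rule two_step_contraction_bound[OF q_nonneg]) (simp_all add: snd_contraction)
  moreover have "\<dots> \<le> 1 * (\<bar>snd (s 0) - Y\<bar> + \<bar>snd (s 1) - Y\<bar>)"
    using q_nonneg q_less_1 by (intro mult_right_mono power_le_one) auto
  ultimately show ?thesis
    using d by simp
qed

text \<open>The constant is \<open>(1 + 3 * L) + 3\<close> with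
  \<open>L = \<alpha>1 / A1\<^sup>2\<close>: the last 3 bounds the second component,
  \<open>3 * L\<close> the first component after a step, and the 1 covers time 0, where the first
  component is not yet determined by a second one.\<close>

lemma solution_error_bound:
  assumes "dist (s 0) (X, Y) \<le> Y / 2"
  shows "dist (s n) (X, Y) \<le> (4 + 3 * (\<alpha>1 / A1\<^sup>2)) * dist (s 0) (X, Y)"
proof -
  let ?d = "dist (s 0) (X, Y)" and ?L = "\<alpha>1 / A1\<^sup>2"
  have L: "?L \<ge> 0"
    using pos by simp
  have "\<bar>fst (s n) - X\<bar> \<le> (1 + 3 * ?L) * ?d"
  proof (cases n)
    case 0
    have "\<bar>fst (s 0) - X\<bar> \<le> ?d"
      using dist_fst_le[of "s 0" "(X, Y)"] by (simp add: dist_real_def)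
    moreover have "0 \<le> 3 * ?L * ?d"
      using L by (intro mult_nonneg_nonneg) auto
    ultimately show ?thesis
      using 0 by (simp add: distrib_right del: times_divide_eq_right times_divide_eq_left)
  next
    case (Suc m)
    have "\<bar>fst (s n) - X\<bar> \<le> ?L * \<bar>snd (s m) - Y\<bar>"
      unfolding Suc by (rule fst_Suc_error)
    also have "\<dots> \<le> ?L * (3 * ?d)"
      by (rule mult_left_mono[OF snd_error_bound[OF assms] L])
    also have "\<dots> \<le> (1 + 3 * ?L) * ?d"
      by (simp add: algebra_simps)
    finally show ?thesis .
  qed
  moreover have "dist (s n) (X, Y) \<le> \<bar>fst (s n) - X\<bar> + \<bar>snd (s n) - Y\<bar>"
    by (simp add: dist_prod_def dist_real_def sqrt_sum_squares_le_sum_abs)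
  moreover note snd_error_bound[OF assms, of n]
  ultimately have "dist (s n) (X, Y) \<le> (1 + 3 * ?L) * ?d + 3 * ?d"
    by linarith
  then show ?thesis
    by (simp add: distrib_right)
qed

end

lemma lyapunov_stable_XY: "lyapunov_stable F D (X, Y)"
  unfolding lyapunov_stable_def
proof (intro allI impI)
  fix \<epsilon> :: real
  assume "\<epsilon> > 0"
  define K where "K = 4 + 3 * (\<alpha>1 / A1\<^sup>2)"
  have K: "K > 0"
    using pos by (simp add: K_def add_pos_nonneg)
  show "\<exists>\<delta>>0. \<forall>s. is_solution F s \<and> admissible F D (s 0) \<and> dist (s 0) (X, Y) < \<delta>
          \<longrightarrow> (\<forall>n. dist (s n) (X, Y) < \<epsilon>)"
  \<comment> \<open>The bound \<open>Y / 2\<close> makes the linear error estimate available;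
    \<open>\<epsilon> / K\<close> then absorbs its constant.\<close>
  proof (intro exI[of _ "min (Y / 2) (\<epsilon> / K)"] conjI allI impI)
    show "0 < min (Y / 2) (\<epsilon> / K)"
      using Y_pos K \<open>\<epsilon> > 0\<close> by simp
  next
    fix s n
    assume s: "is_solution F s \<and> admissible F D (s 0) \<and> dist (s 0) (X, Y) < min (Y / 2) (\<epsilon> / K)"
    then have "dist (s n) (X, Y) \<le> K * dist (s 0) (X, Y)"
      unfolding K_def by (intro solution_error_bound) auto
    also have "\<dots> < \<epsilon>"
      using s K by (simp add: field_simps)
    finally show "dist (s n) (X, Y) < \<epsilon>" .
  qed
qed

lemma globally_asymptotically_stable_XY: "globally_asymptotically_stable F D (X, Y)"
  using lyapunov_stable_XY solution_tendsto
  by (auto simp: globally_asymptotically_stable_def globally_attracting_def)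

text \<open>The constant sequence at an equilibrium is an admissible solution, so its limit
  \<open>z\<close> must be the global attractor.\<close>

lemma equilibrium_unique:
  assumes "equilibrium F D z"
  shows "z = (X, Y)"
  using solution_tendsto[of "\<lambda>n. z"] assms by (simp add: equilibrium_def LIMSEQ_const_iff)

end

theorem theorem13:
  fixes \<alpha>1 A1 \<alpha>2 \<gamma>2 :: real
  assumes "\<alpha>1 > 0" and "A1 > 0" and "\<alpha>2 > 0" and "\<gamma>2 > 0"
  shows "(\<exists>!z. equilibrium (rat_step \<alpha>1 A1 \<alpha>2 \<gamma>2) (rat_dom A1) z)
    \<and> equilibrium (rat_step \<alpha>1 A1 \<alpha>2 \<gamma>2) (rat_dom A1)
        (2 * \<alpha>1 / (2 * A1 + \<gamma>2 + sqrt (\<gamma>2\<^sup>2 + 4 * \<alpha>2)), (\<gamma>2 + sqrt (\<gamma>2\<^sup>2 + 4 * \<alpha>2)) / 2)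
    \<and> globally_asymptotically_stable (rat_step \<alpha>1 A1 \<alpha>2 \<gamma>2) (rat_dom A1)
        (2 * \<alpha>1 / (2 * A1 + \<gamma>2 + sqrt (\<gamma>2\<^sup>2 + 4 * \<alpha>2)), (\<gamma>2 + sqrt (\<gamma>2\<^sup>2 + 4 * \<alpha>2)) / 2)"
proof -
  interpret rational_system \<alpha>1 A1 \<alpha>2 \<gamma>2
    using assms by unfold_locales
  show ?thesis
    unfolding X_eq[symmetric] Y_def[symmetric]
    using equilibrium_XY equilibrium_unique globally_asymptotically_stable_XY by blast
qed

end
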